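(* Let $f,g:I\to\mathbb{R}$ be strictly increasing functions. Then the following assertions are equivalent. (i) For all $n\in\mathbb{N}$ and $x\in I^n$, $A^{[n]}_{f}(x)=A^{[n]}_{g}(x)$. (ii) For all $n\in\mathbb{N}$, $x\in I^n$, and $\lambda\in\Lambda_n$, $\widetilde{A}^{[n]}_{f}(x;\lambda)=\widetilde{A}^{[n]}_{g}(x;\lambda)$. (iii) There exists $n\in\mathbb{N}\setminus\{1\}$ such that, for all $x\in I^n$ and $\lambda\in\Lambda_n$, $\widetilde{A}^{[n]}_{f}(x;\lambda)=\widetilde{A}^{[n]}_{g}(x;\lambda)$. (iv) For all $x,y\in I$ with $x<y$ and $t\in (x,y)\cap C_f\cap C_g$, $$\frac{f(y)-f(t)}{f(y)-f(x)}=\frac{g(y)-g(t)}{g(y)-g(x)}.$$ (v) There exist two real constants $\alpha>0$ and $\beta$ such that, for all $x\in I$, $f(x)=\alpha g(x)+\beta$.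
   Context: $I$ is a nonempty open subinterval of $\mathbb{R}$. "Increasing" means nondecreasing; $\mathrm{conv}(S)$ is the smallest interval containing $S\subseteq\mathbb{R}$. For a strictly increasing (not necessarily continuous) $f:I\to\mathbb{R}$, it is known that there is a unique increasing function $f^{(-1)}:\mathrm{conv}(f(I))\to I$ with $f^{(-1)}(f(x))=x$ for all $x\in I$ (the generalized inverse of $f$; it is continuous). For $n\in\mathbb{N}=\{1,2,\dots\}$ let $\Lambda_n:=\{\lambda\in[0,\infty)^n : \lambda_1+\dots+\lambda_n>0\}$. The $n$-variable generalized quasiarithmetic mean $A_f^{[n]}:I^n\to I$ and its weighted version $\widetilde{A}_f^{[n]}:I^n\times\Lambda_n\to I$ are $$A^{[n]}_{f}(x):=f^{(-1)}\Big(\frac{f(x_1)+\dots+f(x_n)}{n}\Big),\qquad \widetilde{A}^{[n]}_{f}(x;\lambda):=f^{(-1)}\Big(\frac{\lambda_1f(x_1)+\dots+\lambda_nf(x_n)}{\lambda_1+\dots+\lambda_n}\Big).$$ $C_f$ denotes the set of points of $I$ at which $f$ is continuous. *)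

theory Defs
  imports "HOL-Analysis.Analysis"
begin

text \<open>For sets of reals, the smallest interval containing \<open>S\<close> is \<open>convex hull S\<close>.
  The generalized inverse is unique only as a function on \<open>convex hull (f ` I)\<close>; since functions
  are total, the carrier \<open>\<rightarrow>\<^sub>E\<close> fixes the value \<open>undefined\<close> outside of that interval.\<close>

definition is_gen_inverse :: "real set \<Rightarrow> (real \<Rightarrow> real) \<Rightarrow> (real \<Rightarrow> real) \<Rightarrow> bool" where
  "is_gen_inverse I f h \<longleftrightarrow>
     h \<in> (convex hull (f ` I)) \<rightarrow>\<^sub>E I \<and> mono_on (convex hull (f ` I)) h \<and> (\<forall>x\<in>I. h (f x) = x)"

definition gen_inverse :: "real set \<Rightarrow> (real \<Rightarrow> real) \<Rightarrow> real \<Rightarrow> real" where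
  "gen_inverse I f = (THE h. is_gen_inverse I f h)"

lemma convex_hull_real_bounds:
  fixes S :: "real set"
  assumes "u \<in> convex hull S"
  shows "\<exists>a\<in>S. \<exists>b\<in>S. a \<le> u \<and> u \<le> b"
proof -
  have "is_interval {u. \<exists>a\<in>S. \<exists>b\<in>S. a \<le> u \<and> u \<le> b}"
    unfolding is_interval_1 by (smt (verit) mem_Collect_eq)
  then have "convex hull S \<subseteq> {u. \<exists>a\<in>S. \<exists>b\<in>S. a \<le> u \<and> u \<le> b}"
    by (intro hull_minimal) (auto simp: is_interval_convex_1)
  with assms show ?thesis by blast
qed

lemma ex1_gen_inverse:
  fixes I :: "real set" and f :: "real \<Rightarrow> real"
  assumes I: "is_interval I" and f: "strict_mono_on I f"
  shows "\<exists>!h. is_gen_inverse I f h"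
proof -
  let ?C = "convex hull (f ` I)"
  have fC: "f x \<in> ?C" if "x \<in> I" for x
    using that by (simp add: hull_inc)
  have fle: "f x \<le> f y \<longleftrightarrow> x \<le> y" if "x \<in> I" "y \<in> I" for x y
    using strict_mono_on_leD[OF f that] strict_mono_onD[OF f that(2,1)]
    by (meson linorder_not_le)
  define L where "L u = {x\<in>I. f x \<le> u}" for u
  define h where "h = restrict (\<lambda>u. Sup (L u)) ?C"
  have bounds: "\<exists>a\<in>I. \<exists>b\<in>I. a \<in> L u \<and> (\<forall>x\<in>L u. x \<le> b)" if u: "u \<in> ?C" for u
  proof -
    obtain a b where "a \<in> I" "b \<in> I" "f a \<le> u" "u \<le> f b"
      using convex_hull_real_bounds[OF u] by blast
    moreover have "x \<le> b" if "x \<in> L u" for x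
      using that fle[of x b] \<open>b \<in> I\<close> \<open>u \<le> f b\<close> by (simp add: L_def)
    ultimately show ?thesis
      by (auto simp: L_def)
  qed
  have hI: "h u \<in> I" if u: "u \<in> ?C" for u
  proof -
    obtain a b where ab: "a \<in> I" "b \<in> I" "a \<in> L u" "\<forall>x\<in>L u. x \<le> b"
      using bounds[OF u] by blast
    have "a \<le> Sup (L u)" by (rule cSup_upper) (use ab in \<open>auto intro: bdd_aboveI\<close>)
    moreover have "Sup (L u) \<le> b" by (rule cSup_least) (use ab in auto)
    ultimately have "Sup (L u) \<in> I"
      by (rule mem_is_interval_1_I[OF I ab(1,2)])
    then show ?thesis using u by (simp add: h_def)
  qed
  have hmono: "mono_on ?C h"
  proof (rule mono_onI)
    fix u v assume uv: "u \<in> ?C" "v \<in> ?C" "u \<le> v"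
    have "Sup (L u) \<le> Sup (L v)"
    proof (rule cSup_subset_mono)
      show "L u \<noteq> {}" using bounds[OF uv(1)] by blast
      show "bdd_above (L v)" using bounds[OF uv(2)] by (auto simp: bdd_above_def)
      show "L u \<subseteq> L v" using uv(3) by (auto simp: L_def)
    qed
    then show "h u \<le> h v" using uv by (simp add: h_def)
  qed
  have hf: "h (f x) = x" if x: "x \<in> I" for x
  proof -
    have "Sup (L (f x)) = x"
      by (rule cSup_eq_maximum) (use x fle in \<open>auto simp: L_def\<close>)
    then show ?thesis using fC[OF x] by (simp add: h_def)
  qed
  have "is_gen_inverse I f h"
    unfolding is_gen_inverse_def using hI hmono hf by (auto simp: h_def)
  moreover have "p = q" if p: "is_gen_inverse I f p" and q: "is_gen_inverse I f q" for p q
  proof -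
    have le: "p' u \<le> q' u"
      if p': "is_gen_inverse I f p'" and q': "is_gen_inverse I f q'" and u: "u \<in> ?C" for p' q' u
    proof (rule ccontr)
      assume "\<not> p' u \<le> q' u"
      then obtain t where t: "q' u < t" "t < p' u" using dense not_le by blast
      have "q' u \<in> I" "p' u \<in> I" using p' q' u by (auto simp: is_gen_inverse_def)
      then have tI: "t \<in> I"
        by (rule mem_is_interval_1_I[OF I]) (use t in auto)
      show False
      proof (cases "f t \<le> u")
        case True
        then have "q' (f t) \<le> q' u"
          using q' u fC[OF tI] by (auto simp: is_gen_inverse_def mono_on_def)
        then show False using q' tI t by (simp add: is_gen_inverse_def)
      next
        case False
        then have "p' u \<le> p' (f t)"
          using p' u fC[OF tI] by (auto simp: is_gen_inverse_def mono_on_def)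
        then show False using p' tI t by (simp add: is_gen_inverse_def)
      qed
    qed
    show ?thesis
    proof (rule PiE_ext)
      show "p \<in> ?C \<rightarrow>\<^sub>E I" "q \<in> ?C \<rightarrow>\<^sub>E I" using p q by (simp_all add: is_gen_inverse_def)
      show "p u = q u" if "u \<in> ?C" for u using le[OF p q that] le[OF q p that] by simp
    qed
  qed
  ultimately show ?thesis by blast
qed

text \<open>An \<open>n\<close>-tuple over \<open>S\<close> is an element of \<open>{1..n} \<rightarrow>\<^sub>E S\<close>.\<close>

definition weights :: "nat \<Rightarrow> (nat \<Rightarrow> real) set" where
  "weights n = {l \<in> {1..n} \<rightarrow>\<^sub>E {0..}. (\<Sum>i=1..n. l i) > 0}"

definition qa_mean :: "real set \<Rightarrow> (real \<Rightarrow> real) \<Rightarrow> nat \<Rightarrow> (nat \<Rightarrow> real) \<Rightarrow> real" where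
  "qa_mean I f n x = gen_inverse I f ((\<Sum>i=1..n. f (x i)) / real n)"

definition wqa_mean ::
    "real set \<Rightarrow> (real \<Rightarrow> real) \<Rightarrow> nat \<Rightarrow> (nat \<Rightarrow> real) \<Rightarrow> (nat \<Rightarrow> real) \<Rightarrow> real" where
  "wqa_mean I f n x l = gen_inverse I f ((\<Sum>i=1..n. l i * f (x i)) / (\<Sum>i=1..n. l i))"

definition cont_points :: "real set \<Rightarrow> (real \<Rightarrow> real) \<Rightarrow> real set" where
  "cont_points I f = {x \<in> I. continuous (at x within I) f}"

definition all_equivalent :: "bool list \<Rightarrow> bool" where
  "all_equivalent Ps \<longleftrightarrow> (\<forall>P \<in> set Ps. \<forall>Q \<in> set Ps. P \<longleftrightarrow> Q)"

end

theory Submission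
  imports Defs
begin

text \<open>For \<open>x < y\<close>, the mean of \<open>x\<close> and \<open>y\<close> with weights \<open>r\<close> and \<open>1 - r\<close> moves from \<open>y\<close> down
  to \<open>x\<close> as \<open>r\<close> grows. A jump of \<open>f\<close> makes it stop for a while, but at a point \<open>t\<close> between
  \<open>x\<close> and \<open>y\<close> where \<open>f\<close> is continuous it does not stop: it is above \<open>t\<close> before \<open>r\<close> reaches
  \<open>(f y - f t) / (f y - f x)\<close> and below \<open>t\<close> afterwards.
  So the means determine this ratio, and, the rationals being dense, rational weights are enough to
  do so (\<open>crossing_weight_eq\<close>). Rational weights occur in unweighted means of tuples
  whose entries are all \<open>x\<close> or \<open>y\<close>, and any real weights in weighted means of \<open>n \<ge> 2\<close> arguments
  of which all but two have weight zero. Hence each condition on means gives the condition on ratios.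

  Equality of the ratios at \<open>x < t < y\<close> says that \<open>(g x, f x)\<close>, \<open>(g t, f t)\<close>, \<open>(g y, f y)\<close> are
  collinear. Only \<open>t\<close> has to be a continuity point, and the continuity points common to \<open>f\<close> and \<open>g\<close>
  are dense, because a monotone function has only countably many discontinuities. Thus every point
  of \<open>I\<close> can be made an end of a collinear triple whose other two points lie on one fixed line
  (\<open>affine_if_crossing_weights_eq\<close>). Conversely, an increasing affine change of \<open>f\<close> commutes with
  convex combinations and is undone by the generalized inverse.\<close>

section \<open>Generalized inverses at points of continuity\<close>

lemma is_gen_inverse_gen_inverse:
  assumes "is_interval I" "strict_mono_on I f"
  shows "is_gen_inverse I f (gen_inverse I f)"
  unfolding gen_inverse_def by (rule theI'[OF ex1_gen_inverse[OF assms]])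

lemma gen_inverse_eqI:
  assumes "is_interval I" "strict_mono_on I f" "is_gen_inverse I f h"
  shows "gen_inverse I f = h"
  unfolding gen_inverse_def
  by (rule the1_equality[where P = "is_gen_inverse I f"])
    (rule ex1_gen_inverse[OF assms(1,2)], rule assms(3))

lemma is_gen_inverse_mono:
  assumes "is_gen_inverse I f h" "u \<in> convex hull (f ` I)" "v \<in> convex hull (f ` I)" "u \<le> v"
  shows "h u \<le> h v"
  using assms by (auto simp: is_gen_inverse_def mono_on_def)

text \<open>In general \<open>u < f t\<close> gives only \<open>h u \<le> t\<close>. Continuity from the left at \<open>t\<close> provides some
  \<open>s < t\<close> with \<open>u < f s\<close>, and then \<open>h u \<le> h (f s) = s\<close>.\<close>

lemma is_gen_inverse_less_cont_point:
  assumes "open I" and h: "is_gen_inverse I f h" and t: "t \<in> cont_points I f"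
    and u: "u \<in> convex hull (f ` I)" "u < f t"
  shows "h u < t"
proof -
  have tI: "t \<in> I" and "(f \<longlongrightarrow> f t) (at t)"
    using t at_within_open[OF _ \<open>open I\<close>]
    by (auto simp: cont_points_def continuous_within)
  then have "\<forall>\<^sub>F s in at_left t. u < f s"
    using order_tendstoD(1)[OF _ u(2)] eventually_at_split by blast
  moreover have "\<forall>\<^sub>F s in at_left t. s \<in> I"
    using eventually_at_in_open'[OF \<open>open I\<close> tI] eventually_at_split by blast
  moreover have "\<forall>\<^sub>F s in at_left t. s < t"
    by (simp add: eventually_at_filter)
  ultimately have "\<forall>\<^sub>F s in at_left t. u < f s \<and> s \<in> I \<and> s < t"
    by eventually_elim simp
  then obtain s where s: "u < f s" "s \<in> I" "s < t"
    using eventually_happens'[OF trivial_limit_at_left_real] by blast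
  have "h u \<le> h (f s)"
    by (rule is_gen_inverse_mono[OF h u(1)]) (use s in \<open>auto intro: hull_inc\<close>)
  also have "\<dots> = s" using h s by (simp add: is_gen_inverse_def)
  finally show ?thesis using s by simp
qed

lemma is_gen_inverse_greater_cont_point:
  assumes "open I" and h: "is_gen_inverse I f h" and t: "t \<in> cont_points I f"
    and u: "u \<in> convex hull (f ` I)" "f t < u"
  shows "t < h u"
proof -
  have tI: "t \<in> I" and "(f \<longlongrightarrow> f t) (at t)"
    using t at_within_open[OF _ \<open>open I\<close>]
    by (auto simp: cont_points_def continuous_within)
  then have "\<forall>\<^sub>F s in at_right t. f s < u"
    using order_tendstoD(2)[OF _ u(2)] eventually_at_split by blast
  moreover have "\<forall>\<^sub>F s in at_right t. s \<in> I"
    using eventually_at_in_open'[OF \<open>open I\<close> tI] eventually_at_split by blast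
  moreover have "\<forall>\<^sub>F s in at_right t. t < s"
    by (simp add: eventually_at_filter)
  ultimately have "\<forall>\<^sub>F s in at_right t. f s < u \<and> s \<in> I \<and> t < s"
    by eventually_elim simp
  then obtain s where s: "f s < u" "s \<in> I" "t < s"
    using eventually_happens'[OF trivial_limit_at_right_real] by blast
  have "s = h (f s)" using h s by (simp add: is_gen_inverse_def)
  also have "\<dots> \<le> h u"
    by (rule is_gen_inverse_mono[OF h _ u(1)]) (use s in \<open>auto intro: hull_inc\<close>)
  finally show ?thesis using s by simp
qed

section \<open>Two-point means determine the ratios\<close>

definition two_point_mean :: "real set \<Rightarrow> (real \<Rightarrow> real) \<Rightarrow> real \<Rightarrow> real \<Rightarrow> real \<Rightarrow> real" where
  "two_point_mean I f r x y = gen_inverse I f (r * f x + (1 - r) * f y)"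

lemma two_point_combination_mem_hull:
  fixes f :: "real \<Rightarrow> real"
  assumes "x \<in> I" "y \<in> I" "0 < r" "r < 1"
  shows "r * f x + (1 - r) * f y \<in> convex hull (f ` I)"
proof -
  have "r *\<^sub>R f x + (1 - r) *\<^sub>R f y \<in> convex hull (f ` I)"
    by (rule convexD) (use assms in \<open>auto intro: hull_inc\<close>)
  then show ?thesis by simp
qed

lemma two_point_mean_less:
  assumes I: "open I" "is_interval I" and f: "strict_mono_on I f"
    and xy: "x \<in> I" "y \<in> I" "x < y" and t: "t \<in> cont_points I f"
    and r: "0 < r" "r < 1" "(f y - f t) / (f y - f x) < r"
  shows "two_point_mean I f r x y < t"
  unfolding two_point_mean_def
proof (rule is_gen_inverse_less_cont_point[OF I(1) is_gen_inverse_gen_inverse[OF I(2) f] t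
      two_point_combination_mem_hull[OF xy(1,2) r(1,2)]])
  have "f x < f y" using strict_mono_onD[OF f] xy by simp
  then show "r * f x + (1 - r) * f y < f t"
    using r(3) by (simp add: field_simps)
qed

lemma two_point_mean_greater:
  assumes I: "open I" "is_interval I" and f: "strict_mono_on I f"
    and xy: "x \<in> I" "y \<in> I" "x < y" and t: "t \<in> cont_points I f"
    and r: "0 < r" "r < 1" "r < (f y - f t) / (f y - f x)"
  shows "t < two_point_mean I f r x y"
  unfolding two_point_mean_def
proof (rule is_gen_inverse_greater_cont_point[OF I(1) is_gen_inverse_gen_inverse[OF I(2) f] t
      two_point_combination_mem_hull[OF xy(1,2) r(1,2)]])
  have "f x < f y" using strict_mono_onD[OF f] xy by simp
  then show "f t < r * f x + (1 - r) * f y"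
    using r(3) by (simp add: field_simps)
qed

lemma crossing_weight_bounds:
  assumes "strict_mono_on I f" "x \<in> I" "y \<in> I" "t \<in> I" "x < t" "t < y"
  shows "0 < (f y - f t) / (f y - f x)" "(f y - f t) / (f y - f x) < (1::real)"
proof -
  have "f x < f t" "f t < f y" using strict_mono_onD[OF assms(1)] assms by auto
  then show "0 < (f y - f t) / (f y - f x)" "(f y - f t) / (f y - f x) < 1"
    by (auto simp: field_simps)
qed

text \<open>A rational weight strictly between two different ratios would put the two means on
  opposite sides of \<open>t\<close>.\<close>

lemma crossing_weight_le:
  assumes I: "open I" "is_interval I"
    and f: "strict_mono_on I f" and g: "strict_mono_on I g"
    and eq: "\<And>r. r \<in> \<rat> \<Longrightarrow> 0 < r \<Longrightarrow> r < 1 \<Longrightarrow> two_point_mean I f r x y = two_point_mean I g r x y"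
    and xy: "x \<in> I" "y \<in> I" and t: "x < t" "t < y" "t \<in> cont_points I f" "t \<in> cont_points I g"
  shows "(g y - g t) / (g y - g x) \<le> (f y - f t) / (f y - f x)"
proof (rule ccontr)
  assume "\<not> ?thesis"
  then obtain r where r: "r \<in> \<rat>" "(f y - f t) / (f y - f x) < r" "r < (g y - g t) / (g y - g x)"
    using Rats_dense_in_real by (meson not_le)
  have "t \<in> I" using t by (simp add: cont_points_def)
  then have r01: "0 < r" "r < 1"
    using r crossing_weight_bounds[OF f xy _ t(1,2)] crossing_weight_bounds[OF g xy _ t(1,2)]
    by linarith+
  have "x < y" using t by simp
  have "two_point_mean I f r x y < t"
    by (rule two_point_mean_less[OF I f xy \<open>x < y\<close> t(3) r01 r(2)])
  also have "t < two_point_mean I g r x y"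
    by (rule two_point_mean_greater[OF I g xy \<open>x < y\<close> t(4) r01 r(3)])
  finally show False using eq[OF r(1) r01] by simp
qed

lemma crossing_weight_eq:
  assumes "open I" "is_interval I" "strict_mono_on I f" "strict_mono_on I g"
    and "\<And>r. r \<in> \<rat> \<Longrightarrow> 0 < r \<Longrightarrow> r < 1 \<Longrightarrow> two_point_mean I f r x y = two_point_mean I g r x y"
    and "x \<in> I" "y \<in> I" "x < t" "t < y" "t \<in> cont_points I f" "t \<in> cont_points I g"
  shows "(f y - f t) / (f y - f x) = (g y - g t) / (g y - g x)"
  by (rule antisym; rule crossing_weight_le) (use assms in auto)

lemma sum_two_blocks:
  fixes a b :: real
  assumes "k \<le> n"
  shows "(\<Sum>i=1..n. if i \<le> k then a else b) = real k * a + real (n - k) * b"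
proof -
  have "{1..n} \<inter> {i. i \<le> k} = {1..k}" "{1..n} \<inter> - {i. i \<le> k} = {k<..n}"
    using assms by auto
  then show ?thesis by (simp add: sum.If_cases)
qed

lemma two_point_mean_eq_if_qa_mean_eq:
  assumes eq: "\<forall>n\<ge>1. \<forall>x \<in> {1..n} \<rightarrow>\<^sub>E I. qa_mean I f n x = qa_mean I g n x"
    and xy: "x \<in> I" "y \<in> I" and r: "r \<in> \<rat>" "0 < r" "r < 1"
  shows "two_point_mean I f r x y = two_point_mean I g r x y"
proof -
  obtain k n :: nat where n: "n \<noteq> 0" and "\<bar>r\<bar> = real k / real n"
    using Rats_abs_nat_div_natE[OF r(1)] by metis
  then have rkn: "r = real k / real n" using r by simp
  then have "real k < real n" using r n by (simp add: divide_less_eq)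
  then have kn: "k \<le> n" by simp
  define z where "z = restrict (\<lambda>i. if i \<le> k then x else y) {1..n}"
  have z: "z \<in> {1..n} \<rightarrow>\<^sub>E I" using xy by (auto simp: z_def)
  have "qa_mean I h n z = two_point_mean I h r x y" for h
  proof -
    have "(\<Sum>i=1..n. h (z i)) = (\<Sum>i=1..n. if i \<le> k then h x else h y)"
      by (rule sum.cong) (auto simp: z_def)
    then have "(\<Sum>i=1..n. h (z i)) / real n = r * h x + (1 - r) * h y"
      using n kn by (simp only: sum_two_blocks[OF kn])
        (simp add: rkn field_simps of_nat_diff)
    then show ?thesis by (simp add: qa_mean_def two_point_mean_def)
  qed
  moreover have "qa_mean I f n z = qa_mean I g n z" using eq z n by simp
  ultimately show ?thesis by simp
qed

lemma two_point_mean_eq_if_wqa_mean_eq: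
  assumes n: "n \<ge> 2"
    and eq: "\<forall>x \<in> {1..n} \<rightarrow>\<^sub>E I. \<forall>l \<in> weights n. wqa_mean I f n x l = wqa_mean I g n x l"
    and xy: "x \<in> I" "y \<in> I" and r: "0 < r" "r < 1"
  shows "two_point_mean I f r x y = two_point_mean I g r x y"
proof -
  define l where "l = restrict (\<lambda>i. if i = 1 then r else if i = 2 then 1 - r else 0) {1..n}"
  define z where "z = restrict (\<lambda>i. if i = 1 then x else y) {1..n}"
  have z: "z \<in> {1..n} \<rightarrow>\<^sub>E I" using xy by (auto simp: z_def)
  have sum: "(\<Sum>i=1..n. l i * h i) = r * h 1 + (1 - r) * h 2" for h :: "nat \<Rightarrow> real"
  proof -
    have "(\<Sum>i=1..n. l i * h i) = (\<Sum>i\<in>{1,2}. l i * h i)"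
      by (rule sum.mono_neutral_right) (use n in \<open>auto simp: l_def\<close>)
    then show ?thesis using n by (simp add: l_def)
  qed
  have suml: "(\<Sum>i=1..n. l i) = 1" using sum[of "\<lambda>_. 1"] by simp
  have "l \<in> weights n" using r suml by (auto simp: weights_def l_def)
  moreover have "wqa_mean I h n z l = two_point_mean I h r x y" for h
    unfolding wqa_mean_def two_point_mean_def suml sum using n by (simp add: z_def)
  moreover have "wqa_mean I f n z l = wqa_mean I g n z l"
    using eq z calculation(1) by blast
  ultimately show ?thesis by simp
qed

section \<open>Equal ratios make the functions affinely related\<close>

text \<open>Two monotone functions have, together, only countably many discontinuities, and so they
  cannot exhaust an interval.\<close>

lemma common_cont_point_between:
  assumes I: "open I" "is_interval I" and f: "strict_mono_on I f" and g: "strict_mono_on I g"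
    and ab: "a \<in> I" "b \<in> I" "a < b"
  obtains c where "a < c" "c < b" "c \<in> cont_points I f" "c \<in> cont_points I g"
proof -
  let ?D = "{c \<in> I. \<not> isCont f c} \<union> {c \<in> I. \<not> isCont g c}"
  have "countable ?D"
    using mono_on_ctble_discont_open[OF \<open>open I\<close> strict_mono_on_imp_mono_on[OF f]]
      mono_on_ctble_discont_open[OF \<open>open I\<close> strict_mono_on_imp_mono_on[OF g]] by simp
  moreover have "uncountable {a<..<b}" using ab by (simp add: uncountable_open_interval)
  ultimately have "\<not> {a<..<b} \<subseteq> ?D" using countable_subset by blast
  then obtain c where c: "c \<in> {a<..<b}" "c \<notin> ?D" by blast
  have "c \<in> I" using mem_is_interval_1_I[OF I(2) ab(1,2), of c] c by simp
  with c show ?thesis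
    by (intro that) (auto simp: cont_points_def continuous_at_imp_continuous_at_within)
qed

text \<open>The residual of an affine ansatz obeys the same interpolation law as \<open>f\<close> and \<open>g\<close>, and so,
  if \<open>k\<close> is neither \<open>0\<close> nor \<open>1\<close>, it vanishes at all three points once it vanishes at two of them.\<close>

lemma affine_residual_interpolates:
  fixes f g :: "real \<Rightarrow> real" and \<alpha> \<beta> :: real
  assumes "f x \<noteq> f y" "g x \<noteq> g y"
    and "(f y - f t) / (f y - f x) = k" "(g y - g t) / (g y - g x) = k"
  defines "e \<equiv> \<lambda>p. f p - (\<alpha> * g p + \<beta>)"
  shows "e t = k * e x + (1 - k) * e y"
proof -
  have "k * (f y - f x) = f y - f t" "k * (g y - g x) = g y - g t"
    using nonzero_divide_eq_eq[of "f y - f x"] nonzero_divide_eq_eq[of "g y - g x"] assms(1-4)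
    by (metis eq_iff_diff_eq_0)+
  then have ft: "f t = f y - k * (f y - f x)" and gt: "g t = g y - k * (g y - g x)"
    by linarith+
  show ?thesis unfolding e_def ft gt by (simp add: algebra_simps)
qed

lemma affine_if_crossing_weights_eq:
  assumes I: "open I" "is_interval I" "I \<noteq> {}"
    and f: "strict_mono_on I f" and g: "strict_mono_on I g"
    and eq: "\<And>x y t. x \<in> I \<Longrightarrow> y \<in> I \<Longrightarrow> x < t \<Longrightarrow> t < y \<Longrightarrow>
      t \<in> cont_points I f \<Longrightarrow> t \<in> cont_points I g \<Longrightarrow>
      (f y - f t) / (f y - f x) = (g y - g t) / (g y - g x)"
  shows "\<exists>\<alpha> \<beta> :: real. \<alpha> > 0 \<and> (\<forall>x\<in>I. f x = \<alpha> * g x + \<beta>)"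
proof -
  obtain a where a: "a \<in> I" using I by blast
  obtain d where d: "d > 0" "cball a d \<subseteq> I"
    using \<open>open I\<close> a open_contains_cball by blast
  have "a + d \<in> cball a d" using d(1) by (simp add: dist_real_def)
  then have "a + d \<in> I" "a < a + d" using d by auto
  then obtain b where b: "a < b" "b \<in> cont_points I f" "b \<in> cont_points I g"
    using common_cont_point_between[OF I(1,2) f g a] by metis
  then have bI: "b \<in> I" by (simp add: cont_points_def)
  have fab: "f a < f b" and gab: "g a < g b"
    using strict_mono_onD[OF f a bI b(1)] strict_mono_onD[OF g a bI b(1)] by simp_all
  define \<alpha> where "\<alpha> = (f b - f a) / (g b - g a)"
  define \<beta> where "\<beta> = f a - \<alpha> * g a"
  define e where "e p = f p - (\<alpha> * g p + \<beta>)" for p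
  have ea: "e a = 0" by (simp add: e_def \<beta>_def)
  have "\<alpha> * (g b - g a) = f b - f a" using gab by (simp add: \<alpha>_def)
  then have eb: "e b = 0" by (simp add: e_def \<beta>_def algebra_simps)
  have e_zeros: "e x = 0 \<Longrightarrow> e y = 0 \<Longrightarrow> e t = 0" "e t = 0 \<Longrightarrow> e y = 0 \<Longrightarrow> e x = 0"
      "e x = 0 \<Longrightarrow> e t = 0 \<Longrightarrow> e y = 0"
    if xyt: "x \<in> I" "y \<in> I" "x < t" "t < y" "t \<in> cont_points I f" "t \<in> cont_points I g"
    for x y t
  proof -
    define k where "k = (f y - f t) / (f y - f x)"
    have "t \<in> I" using xyt(5) by (simp add: cont_points_def)
    then have k: "k \<noteq> 0" "k \<noteq> 1"
      using crossing_weight_bounds[OF f xyt(1,2) _ xyt(3,4)] unfolding k_def by force+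
    have "x < y" using xyt(3,4) by simp
    then have "f x \<noteq> f y" "g x \<noteq> g y"
      using strict_mono_onD[OF f xyt(1,2)] strict_mono_onD[OF g xyt(1,2)] by simp_all
    then have et: "e t = k * e x + (1 - k) * e y"
      unfolding e_def
      by (rule affine_residual_interpolates) (simp_all only: k_def eq[OF xyt])
    show "e x = 0 \<Longrightarrow> e y = 0 \<Longrightarrow> e t = 0" using et by simp
    show "e t = 0 \<Longrightarrow> e y = 0 \<Longrightarrow> e x = 0" using et k by simp
    show "e x = 0 \<Longrightarrow> e t = 0 \<Longrightarrow> e y = 0" using et k by simp
  qed
  have "e p = 0" if p: "p \<in> I" for p
  proof (cases p b rule: linorder_cases)
    case less
    \<comment> \<open>The point \<open>p\<close> may be a discontinuity between \<open>a\<close> and \<open>b\<close>, and so it may not serve as a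
      middle point. A common continuity point \<open>c\<close> is put on the line first; then \<open>p\<close> is an end of
      the triple \<open>p < c < b\<close>.\<close>
    have "max a p \<in> I" "max a p < b" using a p less b(1) by (auto simp: max_def)
    then obtain c where c: "max a p < c" "c < b" "c \<in> cont_points I f" "c \<in> cont_points I g"
      using common_cont_point_between[OF I(1,2) f g _ bI] by metis
    have "a < c" "p < c" using c(1) by simp_all
    have "e c = 0"
      by (rule e_zeros(1)[OF a bI \<open>a < c\<close> c(2-4) ea eb])
    then show ?thesis
      by (rule e_zeros(2)[OF p bI \<open>p < c\<close> c(2-4) _ eb])
  next
    case equal
    then show ?thesis using eb by simp
  next
    case greater
    then show ?thesis by (rule e_zeros(3)[OF a p b(1) _ b(2,3) ea eb])
  qed
  moreover have "\<alpha> > 0" using fab gab by (simp add: \<alpha>_def)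
  ultimately show ?thesis unfolding e_def by (metis eq_iff_diff_eq_0)
qed

section \<open>Affine changes preserve the means\<close>

text \<open>The left-hand side, as a function of \<open>u\<close>, is increasing and takes \<open>g x\<close> to \<open>x\<close>; by uniqueness
  it is the generalized inverse of \<open>g\<close>.\<close>

lemma gen_inverse_affine:
  assumes I: "is_interval I" and f: "strict_mono_on I f" and g: "strict_mono_on I g"
    and "\<alpha> > 0" and fg: "\<forall>x\<in>I. f x = \<alpha> * g x + \<beta>"
    and u: "u \<in> convex hull (g ` I)"
  shows "gen_inverse I f (\<alpha> * u + \<beta>) = gen_inverse I g u"
proof -
  let ?C = "convex hull (g ` I)" and ?D = "convex hull (f ` I)"
  note h = is_gen_inverse_gen_inverse[OF I f]
  have "f ` I = (\<lambda>v. \<beta> + \<alpha> *\<^sub>R v) ` g ` I"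
    unfolding image_image using fg by (intro image_cong) auto
  then have D: "?D = (\<lambda>v. \<beta> + \<alpha> *\<^sub>R v) ` ?C"
    by (simp only: convex_hull_affinity)
  have mem: "\<alpha> * v + \<beta> \<in> ?D" if "v \<in> ?C" for v
    unfolding D using that by (auto simp: add.commute)
  have "is_gen_inverse I g (restrict (\<lambda>v. gen_inverse I f (\<alpha> * v + \<beta>)) ?C)" (is "is_gen_inverse I g ?h")
    unfolding is_gen_inverse_def
  proof (intro conjI ballI)
    show "?h \<in> ?C \<rightarrow>\<^sub>E I"
      using h mem by (auto simp: is_gen_inverse_def)
    show "mono_on ?C ?h"
      using is_gen_inverse_mono[OF h mem mem] \<open>\<alpha> > 0\<close> by (intro mono_onI) auto
    fix x assume "x \<in> I"
    then show "?h (g x) = x"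
      using h fg hull_inc[of "g x" "g ` I" convex] by (auto simp: is_gen_inverse_def)
  qed
  then show ?thesis using gen_inverse_eqI[OF I g] u by simp
qed

lemma wqa_mean_affine:
  assumes I: "is_interval I" and f: "strict_mono_on I f" and g: "strict_mono_on I g"
    and "\<alpha> > 0" and fg: "\<forall>x\<in>I. f x = \<alpha> * g x + \<beta>"
    and x: "x \<in> {1..n} \<rightarrow>\<^sub>E I" and l: "l \<in> weights n"
  shows "wqa_mean I f n x l = wqa_mean I g n x l"
proof -
  let ?L = "\<Sum>i=1..n. l i"
  have L: "?L > 0" and nonneg: "\<And>i. i \<in> {1..n} \<Longrightarrow> 0 \<le> l i"
    using l by (auto simp: weights_def PiE_def Pi_def)
  have "(\<Sum>i=1..n. (l i / ?L) *\<^sub>R g (x i)) \<in> convex hull (g ` I)"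
  proof (rule convex_sum)
    show "(\<Sum>i=1..n. l i / ?L) = 1"
      using L by (simp flip: sum_divide_distrib)
    show "0 \<le> l i / ?L" if "i \<in> {1..n}" for i
      using L nonneg[OF that] by simp
    show "g (x i) \<in> convex hull (g ` I)" if "i \<in> {1..n}" for i
      using x that by (intro hull_inc) auto
  qed auto
  moreover have "(\<Sum>i=1..n. (l i / ?L) *\<^sub>R g (x i)) = (\<Sum>i=1..n. l i * g (x i)) / ?L"
    by (simp add: sum_divide_distrib)
  ultimately have mem: "(\<Sum>i=1..n. l i * g (x i)) / ?L \<in> convex hull (g ` I)"
    by simp
  have "(\<Sum>i=1..n. l i * f (x i)) = (\<Sum>i=1..n. \<alpha> * (l i * g (x i)) + l i * \<beta>)"
    by (rule sum.cong) (use x fg in \<open>auto simp: PiE_def Pi_def algebra_simps\<close>)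
  also have "\<dots> = \<alpha> * (\<Sum>i=1..n. l i * g (x i)) + ?L * \<beta>"
    by (simp add: sum.distrib sum_distrib_left sum_distrib_right)
  finally have "(\<Sum>i=1..n. l i * f (x i)) / ?L = \<alpha> * ((\<Sum>i=1..n. l i * g (x i)) / ?L) + \<beta>"
    using L by (simp add: add_divide_distrib)
  then show ?thesis
    unfolding wqa_mean_def using gen_inverse_affine[OF I f g \<open>\<alpha> > 0\<close> fg mem] by simp
qed

lemma qa_mean_eq_wqa_mean:
  "qa_mean I f n x = wqa_mean I f n x (restrict (\<lambda>_. 1) {1..n})"
  by (simp add: qa_mean_def wqa_mean_def)

lemma all_equivalentI:
  assumes "\<And>P. P \<in> set Ps \<Longrightarrow> P = Q"
  shows "all_equivalent Ps"
  unfolding all_equivalent_def using assms by blast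

section \<open>Equality of generalized quasiarithmetic means\<close>

theorem corollary4p2:
  fixes I :: "real set" and f g :: "real \<Rightarrow> real"
  assumes "open I" and "is_interval I" and "I \<noteq> {}"
    and "strict_mono_on I f" and "strict_mono_on I g"
  shows "all_equivalent
    [\<forall>n\<ge>1. \<forall>x \<in> {1..n} \<rightarrow>\<^sub>E I. qa_mean I f n x = qa_mean I g n x,
     \<forall>n\<ge>1. \<forall>x \<in> {1..n} \<rightarrow>\<^sub>E I. \<forall>l \<in> weights n. wqa_mean I f n x l = wqa_mean I g n x l,
     \<exists>n\<ge>2. \<forall>x \<in> {1..n} \<rightarrow>\<^sub>E I. \<forall>l \<in> weights n. wqa_mean I f n x l = wqa_mean I g n x l,
     \<forall>x\<in>I. \<forall>y\<in>I. x < y \<longrightarrow>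
       (\<forall>t \<in> {x<..<y} \<inter> cont_points I f \<inter> cont_points I g.
          (f y - f t) / (f y - f x) = (g y - g t) / (g y - g x)),
     \<exists>\<alpha> \<beta> :: real. \<alpha> > 0 \<and> (\<forall>x\<in>I. f x = \<alpha> * g x + \<beta>)]"
    (is "all_equivalent [?i, ?ii, ?iii, ?iv, ?v]")
proof -
  note crossing = crossing_weight_eq[OF assms(1,2,4,5)]
  have "?iv" if ?i
    using crossing two_point_mean_eq_if_qa_mean_eq[OF that] by auto
  moreover have "?iv" if ?iii
  proof -
    from that obtain n where n: "n \<ge> 2"
      "\<forall>x \<in> {1..n} \<rightarrow>\<^sub>E I. \<forall>l \<in> weights n. wqa_mean I f n x l = wqa_mean I g n x l"
      by blast
    show ?thesis using crossing two_point_mean_eq_if_wqa_mean_eq[OF n] by auto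
  qed
  moreover have "?v" if ?iv
    by (rule affine_if_crossing_weights_eq[OF assms]) (use that in auto)
  moreover have "?ii" if ?v
    using that wqa_mean_affine[OF assms(2,4,5)] by blast
  moreover have "?i" if ?ii
  proof (intro allI impI ballI)
    fix n :: nat and x assume n: "n \<ge> 1" and x: "x \<in> {1..n} \<rightarrow>\<^sub>E I"
    have "restrict (\<lambda>_. 1) {1..n} \<in> weights n"
      using n by (auto simp: weights_def)
    then show "qa_mean I f n x = qa_mean I g n x"
      unfolding qa_mean_eq_wqa_mean using that n x by blast
  qed
  moreover have "?iii" if ?ii
    using that by (intro exI[of _ 2]) auto
  ultimately have "P = ?v" if "P \<in> set [?i, ?ii, ?iii, ?iv, ?v]" for P
    using that unfolding list.set insert_iff empty_iff by satx
  then show ?thesis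
    by (rule all_equivalentI)
qed

end
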